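(* For any $m \geq n \geq 1$, \[\mathrm{qc}(m,n) \leq 2 n \left( \log_2 \frac{m}{n + 1} + 4 \right).\] This bound is asymptotically tight.
   Context: Search game on the grid $S_1\times\cdots\times S_d$ with $S_i=\{0,\ldots,n_i-1\}$: Adversary fixes a target $t$; Algorithm queries a point $q$; if $q\neq t$, Adversary answers for every coordinate $i$ one of $t_i<q_i$ or $t_i>q_i$, at least one of these $d$ inequalities being true, and Algorithm does not learn which one. $\mathrm{qc}(n_1,\ldots,n_d)$ denotes the minimum number of queries that guarantees finding the target (the query complexity); $\mathrm{qc}(n^{\times d})=\mathrm{qc}(n,\ldots,n)$. Here $d=2$. *)

theory Defs
  imports Complex_Main
begin

text \<open>
  Points of the grid $S_1 \times \cdots \times S_d$ with $S_i = \{0, \ldots, n_i - 1\}$ are lists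
  of length $d$; the side lengths $n_1, \ldots, n_d$ are the entries of the list \<open>ns\<close>.
\<close>

definition grid :: "nat list \<Rightarrow> nat list set" where
  "grid ns = {p. length p = length ns \<and> (\<forall>i<length ns. p ! i < ns ! i)}"

text \<open>Entry \<open>Lt\<close> (\<open>Gt\<close>) at position \<open>i\<close> of an answer to \<open>q\<close> is the claim that the target is
  smaller (larger) than \<open>q\<close> in coordinate \<open>i\<close>.\<close>

datatype claim = Lt | Gt

fun claim_true :: "claim \<Rightarrow> nat \<Rightarrow> nat \<Rightarrow> bool" where
  "claim_true Lt x y \<longleftrightarrow> x < y"
| "claim_true Gt x y \<longleftrightarrow> x > y"

definition legal_answer :: "nat list \<Rightarrow> nat list \<Rightarrow> claim list \<Rightarrow> bool" where
  "legal_answer t q a \<longleftrightarrow>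
     length a = length q \<and> (\<exists>i<length q. claim_true (a ! i) (t ! i) (q ! i))"

text \<open>A strategy of Algorithm maps the list of answers received so far to the next query; the
  earlier queries are determined by these answers.\<close>

type_synonym strategy = "claim list list \<Rightarrow> nat list"

definition query :: "strategy \<Rightarrow> (nat \<Rightarrow> claim list) \<Rightarrow> nat \<Rightarrow> nat list" where
  "query \<sigma> A j = \<sigma> (map A [0..<j])"

text \<open>The target counts as found when it is queried. The value of \<open>A j\<close> is unconstrained when
  query number \<open>j\<close> hits the target, since no answer is given then.\<close>

definition finds_within :: "nat list \<Rightarrow> strategy \<Rightarrow> nat \<Rightarrow> bool" where
  "finds_within ns \<sigma> k \<longleftrightarrow>
     (\<forall>t\<in>grid ns. \<forall>A.
        (\<forall>j. query \<sigma> A j \<noteq> t \<longrightarrow> legal_answer t (query \<sigma> A j) (A j)) \<longrightarrow>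
        (\<exists>j<k. query \<sigma> A j = t))"

definition qc :: "nat list \<Rightarrow> nat" where
  "qc ns = (LEAST k. \<exists>\<sigma>. range \<sigma> \<subseteq> grid ns \<and> finds_within ns \<sigma> k)"

end

theory Submission
  imports Defs
begin

text \<open>
  An answer to the query \<open>q\<close> removes from the set of candidates a closed quadrant with apex \<open>q\<close>,
  chosen by Adversary, and the game ends when no candidate is left.

  Upper bound: clear the middle row by binary search. If \<open>u, u'\<close> and \<open>l, l'\<close> are the widths
  removed meanwhile on the left and on the right of the rows above and below, respectively, then
  \<open>max u l + max u' l' \<ge> m\<close> because the middle row is empty; hence what is left consists of two
  rectangles with half as many rows and of total width at most \<open>m\<close>. Recursion costs at most
  \<open>2 ^ i * (log 2 (m / 2 ^ i) + O(1))\<close> queries at depth \<open>i\<close>, by concavity of the logarithm.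

  Lower bound: place in row \<open>y\<close> the block of the columns from \<open>y * w\<close> to \<open>(y + 1) * w - 1\<close>,
  where \<open>w = m div n\<close>. As the blocks form a diagonal, Adversary can always answer by an upper left
  or a lower right quadrant that meets only the block of the queried row and that
  leaves at least half of it.
\<close>

section \<open>The candidate game\<close>

text \<open>Histories disappear: a position is just the set of targets consistent with the answers
  so far. The quantifier over \<open>a\<close> lets Adversary choose the target late.\<close>

fun clears :: "nat list \<Rightarrow> nat \<Rightarrow> nat list set \<Rightarrow> bool" where
  "clears ns 0 C \<longleftrightarrow> C = {}"
| "clears ns (Suc k) C \<longleftrightarrow>
     (\<exists>q\<in>grid ns. \<forall>a. length a = length ns \<longrightarrow> clears ns k {t \<in> C. t \<noteq> q \<and> legal_answer t q a})"

lemma clears_subset: "clears ns k C \<Longrightarrow> D \<subseteq> C \<Longrightarrow> clears ns k D"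
proof (induction k arbitrary: C D)
  case (Suc k)
  from Suc.prems(1) obtain q where q: "q \<in> grid ns"
    "\<And>a. length a = length ns \<Longrightarrow> clears ns k {t \<in> C. t \<noteq> q \<and> legal_answer t q a}" by auto
  have "clears ns k {t \<in> D. t \<noteq> q \<and> legal_answer t q a}" if "length a = length ns" for a
    by (rule Suc.IH[OF q(2)[OF that]]) (use Suc.prems(2) in auto)
  with q(1) show ?case by auto
qed auto

lemma clears_Suc:
  assumes "grid ns \<noteq> {}"
  shows "clears ns k C \<Longrightarrow> clears ns (Suc k) C"
proof (induction k arbitrary: C)
  case 0
  then show ?case using assms by auto
next
  case (Suc k)
  from Suc.prems obtain q where q: "q \<in> grid ns"
    "\<And>a. length a = length ns \<Longrightarrow> clears ns k {t \<in> C. t \<noteq> q \<and> legal_answer t q a}" by auto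
  then show ?case using Suc.IH by (subst clears.simps(2)) blast
qed

lemma clears_mono:
  assumes "grid ns \<noteq> {}" "clears ns k C" "k \<le> l" "D \<subseteq> C"
  shows "clears ns l D"
proof -
  have "clears ns l C"
    using assms(3,2) by (induction rule: dec_induct) (use clears_Suc[OF assms(1)] in blast)+
  then show ?thesis using clears_subset assms(4) by blast
qed

text \<open>The queries for \<open>C\<close> come first. Their answers can only shrink
  \<open>D\<close>, so \<open>l\<close> queries still suffice for what is left of it.\<close>

lemma clears_Un: "clears ns k C \<Longrightarrow> clears ns l D \<Longrightarrow> clears ns (k + l) (C \<union> D)"
proof (induction k arbitrary: C D)
  case (Suc k)
  from Suc.prems(1) obtain q where q: "q \<in> grid ns"
    "\<And>a. length a = length ns \<Longrightarrow> clears ns k {t \<in> C. t \<noteq> q \<and> legal_answer t q a}" by auto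
  have "clears ns (k + l) {t \<in> C \<union> D. t \<noteq> q \<and> legal_answer t q a}" if "length a = length ns" for a
  proof -
    have "clears ns l {t \<in> D. t \<noteq> q \<and> legal_answer t q a}"
      by (rule clears_subset[OF Suc.prems(2)]) auto
    from Suc.IH[OF q(2)[OF that] this] show ?thesis
      by (rule clears_subset) auto
  qed
  with q(1) show ?case by auto
qed auto

section \<open>Strategies versus the candidate game\<close>

lemma query_0: "query \<sigma> A 0 = \<sigma> []"
  by (simp add: query_def)

text \<open>Play after the first answer is again a play, of the strategy with that answer built in;
  this matches the recursion of \<open>clears\<close>.\<close>

lemma query_Suc: "query \<sigma> A (Suc j) = query (\<lambda>as. \<sigma> (A 0 # as)) (\<lambda>i. A (Suc i)) j"
proof -
  have "[0..<Suc j] = 0 # map Suc [0..<j]"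
    by (simp add: upt_conv_Cons map_Suc_upt del: upt_Suc)
  then show ?thesis by (simp add: query_def comp_def del: upt_Suc)
qed

lemma length_grid: "q \<in> grid ns \<Longrightarrow> length q = length ns"
  by (simp add: grid_def)

lemma clears_imp_strategy:
  assumes "grid ns \<noteq> {}"
  shows "clears ns k C \<Longrightarrow> \<exists>\<sigma>. range \<sigma> \<subseteq> grid ns \<and>
    (\<forall>t\<in>C. \<forall>A. (\<forall>j. query \<sigma> A j \<noteq> t \<longrightarrow> legal_answer t (query \<sigma> A j) (A j)) \<longrightarrow>
       (\<exists>j<k. query \<sigma> A j = t))"
proof (induction k arbitrary: C)
  case 0
  obtain q where "q \<in> grid ns" using assms by auto
  then show ?case using 0 by (intro exI[of _ "\<lambda>_. q"]) auto
next
  case (Suc k)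
  from Suc.prems obtain q where q: "q \<in> grid ns"
    "\<And>a. length a = length ns \<Longrightarrow> clears ns k {t \<in> C. t \<noteq> q \<and> legal_answer t q a}" by auto
  have "\<forall>a. \<exists>\<sigma>. length a = length ns \<longrightarrow> range \<sigma> \<subseteq> grid ns \<and>
    (\<forall>t\<in>{t \<in> C. t \<noteq> q \<and> legal_answer t q a}. \<forall>A.
       (\<forall>j. query \<sigma> A j \<noteq> t \<longrightarrow> legal_answer t (query \<sigma> A j) (A j)) \<longrightarrow>
       (\<exists>j<k. query \<sigma> A j = t))"
    using Suc.IH q(2) by blast
  from choice[OF this] obtain S where
    S: "\<forall>a. length a = length ns \<longrightarrow> range (S a) \<subseteq> grid ns \<and>
    (\<forall>t\<in>{t \<in> C. t \<noteq> q \<and> legal_answer t q a}. \<forall>A.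
       (\<forall>j. query (S a) A j \<noteq> t \<longrightarrow> legal_answer t (query (S a) A j) (A j)) \<longrightarrow>
       (\<exists>j<k. query (S a) A j = t))" ..
  \<comment> \<open>\<open>S a\<close> takes over after the first answer \<open>a\<close>. For an
    answer of the wrong length, which is never legal, \<open>q\<close> only keeps the range inside
    the grid.\<close>
  define \<sigma> where "\<sigma> = (\<lambda>as. case as of [] \<Rightarrow> q
    | a # as' \<Rightarrow> if length a = length ns then S a as' else q)"
  have "range \<sigma> \<subseteq> grid ns"
    using q(1) S by (fastforce simp: \<sigma>_def split: list.splits)
  moreover have "\<exists>j<Suc k. query \<sigma> A j = t"
    if t: "t \<in> C" and legal: "\<And>j. query \<sigma> A j \<noteq> t \<Longrightarrow> legal_answer t (query \<sigma> A j) (A j)" for t A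
  proof (cases "q = t")
    case True
    then show ?thesis by (auto simp: query_0 \<sigma>_def)
  next
    case False
    then have la: "legal_answer t q (A 0)" using legal[of 0] by (simp add: query_0 \<sigma>_def)
    then have len: "length (A 0) = length ns"
      using q(1) by (simp add: legal_answer_def length_grid)
    have step: "query \<sigma> A (Suc j) = query (S (A 0)) (\<lambda>i. A (Suc i)) j" for j
      by (simp add: query_Suc \<sigma>_def len)
    have "\<exists>j<k. query (S (A 0)) (\<lambda>i. A (Suc i)) j = t"
      using S len t False la legal[of "Suc _"] unfolding step by blast
    then show ?thesis using step by auto
  qed
  ultimately show ?case by blast
qed

text \<open>The equation is not circular: query \<open>j\<close> depends only on the answers before
  \<open>j\<close>, so the histories \<open>h j\<close> can be built by recursion.\<close>

lemma ex_answer_sequence: "\<exists>A. \<forall>j. A j = f (query \<sigma> A j)"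
proof -
  define h where "h = rec_nat [] (\<lambda>_ as. as @ [f (\<sigma> as)])"
  have "map (\<lambda>j. f (\<sigma> (h j))) [0..<j] = h j" for j
    by (induction j) (auto simp: h_def)
  then have "f (\<sigma> (h j)) = f (query \<sigma> (\<lambda>j. f (\<sigma> (h j))) j)" for j
    by (simp add: query_def)
  then show ?thesis by (intro exI[of _ "\<lambda>j. f (\<sigma> (h j))"]) blast
qed

lemma ex_legal_answer:
  assumes "length t = length q" "t \<noteq> q"
  shows "\<exists>a. legal_answer t q a"
proof -
  obtain i where i: "i < length q" "t ! i \<noteq> q ! i" using assms by (metis nth_equalityI)
  then have "claim_true Lt (t ! i) (q ! i) \<or> claim_true Gt (t ! i) (q ! i)" by auto
  then obtain c where "claim_true c (t ! i) (q ! i)" by blast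
  then have "legal_answer t q (replicate (length q) c)"
    using i by (auto simp: legal_answer_def)
  then show ?thesis ..
qed

lemma strategy_imp_clears:
  assumes "range \<sigma> \<subseteq> grid ns" "C \<subseteq> grid ns"
    "\<forall>t\<in>C. \<forall>A. (\<forall>j. query \<sigma> A j \<noteq> t \<longrightarrow> legal_answer t (query \<sigma> A j) (A j)) \<longrightarrow>
       (\<exists>j<k. query \<sigma> A j = t)"
  shows "clears ns k C"
  using assms
proof (induction k arbitrary: \<sigma> C)
  case 0
  \<comment> \<open>A strategy cannot succeed within zero queries, so it suffices to exhibit one
    sequence of answers that is legal for \<open>t\<close> forever.\<close>
  have False if t: "t \<in> C" for t
  proof -
    obtain A where A: "\<And>j. A j = (SOME a. legal_answer t (query \<sigma> A j) a)"
      using ex_answer_sequence[of "\<lambda>q. SOME a. legal_answer t q a" \<sigma>] by blast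
    have "legal_answer t (query \<sigma> A j) (A j)" if "query \<sigma> A j \<noteq> t" for j
    proof -
      have "query \<sigma> A j \<in> grid ns" using 0 by (auto simp: query_def)
      then have "length t = length (query \<sigma> A j)"
        using t 0 length_grid by (metis subsetD)
      then have "\<exists>a. legal_answer t (query \<sigma> A j) a" using ex_legal_answer that by metis
      then show ?thesis by (subst A) (rule someI_ex)
    qed
    then show False using 0(3) t by blast
  qed
  then show ?case by auto
next
  case (Suc k)
  have "clears ns k {t \<in> C. t \<noteq> \<sigma> [] \<and> legal_answer t (\<sigma> []) a}" if "length a = length ns" for a
  proof (rule Suc.IH[of "\<lambda>as. \<sigma> (a # as)"])
    show "range (\<lambda>as. \<sigma> (a # as)) \<subseteq> grid ns" using Suc.prems(1) by auto
    show "{t \<in> C. t \<noteq> \<sigma> [] \<and> legal_answer t (\<sigma> []) a} \<subseteq> grid ns" using Suc.prems(2) by auto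
    show "\<forall>t\<in>{t \<in> C. t \<noteq> \<sigma> [] \<and> legal_answer t (\<sigma> []) a}. \<forall>A.
       (\<forall>j. query (\<lambda>as. \<sigma> (a # as)) A j \<noteq> t \<longrightarrow>
          legal_answer t (query (\<lambda>as. \<sigma> (a # as)) A j) (A j)) \<longrightarrow>
       (\<exists>j<k. query (\<lambda>as. \<sigma> (a # as)) A j = t)"
    proof (intro ballI allI impI)
      fix t A
      assume t: "t \<in> {t \<in> C. t \<noteq> \<sigma> [] \<and> legal_answer t (\<sigma> []) a}"
        and A: "\<forall>j. query (\<lambda>as. \<sigma> (a # as)) A j \<noteq> t \<longrightarrow>
          legal_answer t (query (\<lambda>as. \<sigma> (a # as)) A j) (A j)"
      \<comment> \<open>A candidate that survives \<open>a\<close> admits \<open>a\<close> as first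
        answer, so \<open>a\<close> may be put in front of any legal continuation.\<close>
      define A' where "A' = case_nat a A"
      have step: "query \<sigma> A' (Suc j) = query (\<lambda>as. \<sigma> (a # as)) A j" for j
        by (simp add: query_Suc A'_def)
      have "legal_answer t (query \<sigma> A' j) (A' j)" if "query \<sigma> A' j \<noteq> t" for j
        using that t A by (cases j) (auto simp: step query_0, auto simp: A'_def)
      then obtain j where "j < Suc k" "query \<sigma> A' j = t" using Suc.prems(3) t by blast
      then show "\<exists>j<k. query (\<lambda>as. \<sigma> (a # as)) A j = t"
        using t step by (cases j) (auto simp: query_0)
    qed
  qed
  then show ?case using Suc.prems(1) by (auto intro!: bexI[of _ "\<sigma> []"])
qed

text \<open>Some sufficient \<open>k\<close> must be known for the \<open>LEAST\<close> in
  \<open>qc\<close> to be attained. Lower bounds for \<open>clears\<close> then carry over to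
  \<open>qc\<close>.\<close>

lemma clears_qc:
  assumes "grid ns \<noteq> {}" "clears ns k (grid ns)"
  shows "clears ns (qc ns) (grid ns)"
proof -
  have "\<exists>k \<sigma>. range \<sigma> \<subseteq> grid ns \<and> finds_within ns \<sigma> k"
    using clears_imp_strategy[OF assms] unfolding finds_within_def by blast
  from LeastI_ex[OF this] obtain \<sigma> where "range \<sigma> \<subseteq> grid ns" "finds_within ns \<sigma> (qc ns)"
    unfolding qc_def by blast
  then show ?thesis using strategy_imp_clears[of \<sigma> ns "grid ns"] by (simp add: finds_within_def)
qed

lemma qc_le:
  assumes "grid ns \<noteq> {}" "clears ns k (grid ns)"
  shows "qc ns \<le> k"
  using clears_imp_strategy[OF assms] unfolding qc_def finds_within_def by (intro Least_le) blast

section \<open>Clearing rectangles\<close>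

definition rect :: "nat \<Rightarrow> nat \<Rightarrow> nat \<Rightarrow> nat \<Rightarrow> nat list set" where
  "rect l r b e = {[x, y] | x y. l \<le> x \<and> x < r \<and> b \<le> y \<and> y < e}"

lemma grid_2: "grid [m, n] = rect 0 m 0 n"
proof -
  have "p \<in> grid [m, n] \<longleftrightarrow> p \<in> rect 0 m 0 n" for p
    by (cases p; cases "tl p"; cases "tl (tl p)")
      (auto simp: grid_def rect_def less_Suc_eq nth_Cons')
  then show ?thesis by blast
qed

lemma grid_2_nonempty: "m > 0 \<Longrightarrow> n > 0 \<Longrightarrow> grid [m, n] \<noteq> {}"
  by (force simp: grid_2 rect_def)

lemma legal_answer_2:
  "legal_answer [t1, t2] [x, y] [a, b] \<longleftrightarrow> claim_true a t1 x \<or> claim_true b t2 y"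
  by (auto simp: legal_answer_def less_Suc_eq nth_Cons')

text \<open>Invariant of the binary search: the open segment from \<open>c\<close> to
  \<open>d\<close> of row \<open>y\<close> lies within the column ranges of both rectangles, and
  their total width is at most \<open>m\<close> plus its length. Each answer cuts the segment and
  exactly one rectangle on the same side, the rectangle by at least as much. Once the segment is
  empty, the total width is at most \<open>m\<close>.\<close>

lemma clears_two_rects_and_row:
  assumes sub: "\<And>ul ur ll lr. \<lbrakk>ul \<le> ur; ll \<le> lr; ur \<le> M; lr \<le> M; (ur - ul) + (lr - ll) \<le> m\<rbrakk> \<Longrightarrow>
      clears [M, N] K (rect ul ur (Suc y) e \<union> rect ll lr b y)"
    and "grid [M, N] \<noteq> {}" "y < N"
    and "c \<le> d" "d - c < 2 ^ s" "ul \<le> c" "ll \<le> c" "d \<le> ur" "d \<le> lr" "ur \<le> M" "lr \<le> M"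
    and "(ur - ul) + (lr - ll) \<le> m + (d - c)"
  shows "clears [M, N] (s + K) (rect ul ur (Suc y) e \<union> rect ll lr b y \<union> rect c d y (Suc y))"
  using assms(4-)
proof (induction s arbitrary: c d ul ur ll lr)
  case 0
  then have "rect c d y (Suc y) = {}" by (auto simp: rect_def)
  then show ?case using 0 sub by simp
next
  case (Suc s)
  let ?C = "rect ul ur (Suc y) e \<union> rect ll lr b y \<union> rect c d y (Suc y)"
  show ?case
  proof (cases "c = d")
    case True
    have "clears [M, N] (s + K) ?C"
      by (rule Suc.IH) (use Suc.prems True in auto)
    then show ?thesis using clears_Suc[OF \<open>grid [M, N] \<noteq> {}\<close>]
      unfolding add_Suc by blast
  next
    case False
    \<comment> \<open>The midpoint leaves fewer than \<open>2 ^ s\<close> columns on either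
      side.\<close>
    define x where "x = c + (d - c) div 2"
    have x: "c \<le> x" "x < d" "x - c < 2 ^ s" "d - Suc x < 2 ^ s"
      using False Suc.prems unfolding x_def by auto
    have q: "[x, y] \<in> grid [M, N]" using x Suc.prems \<open>y < N\<close> by (auto simp: grid_2 rect_def)
    have "clears [M, N] (s + K) {t \<in> ?C. t \<noteq> [x, y] \<and> legal_answer t [x, y] a}"
      if "length a = 2" for a
    proof -
      obtain a1 a2 where a: "a = [a1, a2]"
        using \<open>length a = 2\<close> by (auto simp: numeral_2_eq_2 length_Suc_conv)
      show ?thesis
      proof (cases a1; cases a2)
        assume [simp]: "a1 = Gt" "a2 = Lt"
        have "clears [M, N] (s + K)
          (rect (Suc x) ur (Suc y) e \<union> rect ll lr b y \<union> rect (Suc x) d y (Suc y))"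
          by (rule Suc.IH) (use x Suc.prems in auto)
        then show ?thesis
          by (rule clears_subset) (auto simp: rect_def a legal_answer_2)
      next
        assume [simp]: "a1 = Gt" "a2 = Gt"
        have "clears [M, N] (s + K)
          (rect ul ur (Suc y) e \<union> rect (Suc x) lr b y \<union> rect (Suc x) d y (Suc y))"
          by (rule Suc.IH) (use x Suc.prems in auto)
        then show ?thesis
          by (rule clears_subset) (auto simp: rect_def a legal_answer_2)
      next
        assume [simp]: "a1 = Lt" "a2 = Lt"
        have "clears [M, N] (s + K)
          (rect ul x (Suc y) e \<union> rect ll lr b y \<union> rect c x y (Suc y))"
          by (rule Suc.IH) (use x Suc.prems in auto)
        then show ?thesis
          by (rule clears_subset) (auto simp: rect_def a legal_answer_2)
      next
        assume [simp]: "a1 = Lt" "a2 = Gt"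
        have "clears [M, N] (s + K)
          (rect ul ur (Suc y) e \<union> rect ll x b y \<union> rect c x y (Suc y))"
          by (rule Suc.IH) (use x Suc.prems in auto)
        then show ?thesis
          by (rule clears_subset) (auto simp: rect_def a legal_answer_2)
      qed
    qed
    then show ?thesis using q unfolding add_Suc clears.simps by (intro bexI[of _ "[x, y]"]) auto
  qed
qed

text \<open>
  The total number of queries of the recursion. The numerator is \<open>m + n + 1\<close> rather than \<open>m\<close> as
  subrectangles can be arbitrarily narrow, even empty, and the term \<open>- log 2 (n + 1)\<close> makes the
  induction go through: splitting into halves gains \<open>log 2 (n + 1)\<close> up to a constant, which pays for
  the difference between \<open>log 2 m\<close> and \<open>log 2 (m / (n + 1))\<close> in the middle row.
\<close>

definition rect_cost :: "nat \<Rightarrow> nat \<Rightarrow> real" where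
  "rect_cost m n = n * log 2 ((m + n + 1) / (n + 1)) + 5 * n - log 2 (n + 1)"

text \<open>Needed for rounding the cost down to a natural number of queries.\<close>

lemma rect_cost_nonneg: "rect_cost m n \<ge> 0"
proof -
  have "real n + 1 \<le> 2 ^ n"
    by (induction n) auto
  then have "log 2 (real n + 1) \<le> n"
    by (simp add: log_le_iff powr_realpow add_ac)
  moreover have "log 2 ((m + n + 1) / (n + 1)) \<ge> 0"
    by (simp add: field_simps)
  then have "n * log 2 ((m + n + 1) / (n + 1)) \<ge> 0" by simp
  ultimately show ?thesis unfolding rect_cost_def of_nat_add of_nat_1 by linarith
qed

lemma log_le_tangent:
  fixes p q :: real
  assumes "p > 0" "q > 0"
  shows "log 2 p \<le> log 2 q + (p / q - 1) / ln 2"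
proof -
  have "ln (p / q) \<le> p / q - 1" using assms by (intro ln_le_minus_one) auto
  then show ?thesis using assms by (simp add: log_def ln_div field_simps)
qed

text \<open>One recursion step; \<open>log 2 (m + 1) + 1\<close> bounds the binary search in the
  middle row. Shifting \<open>n\<close> by one gives \<open>s = s1 + s2\<close>, and the tangent of
  the logarithm at the common ratio \<open>A / s\<close> bounds both halves. The row's share 5 of
  the linear term is spent as 1 for rounding up, 1 for the error \<open>E / ln 2\<close> and 3 for
  \<open>log 2 8\<close>.\<close>

lemma rect_cost_split:
  assumes n: "n = n1 + n2 + 1" "n1 \<le> n2" "n2 \<le> n1 + 1" and m: "m1 + m2 \<le> m"
  shows "log 2 (real m + 1) + 1 + rect_cost m1 n1 + rect_cost m2 n2 \<le> rect_cost m n"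
proof -
  define A where "A = real (m + n + 1)"
  define A1 where "A1 = real (m1 + n1 + 1)"
  define A2 where "A2 = real (m2 + n2 + 1)"
  define s1 where "s1 = real n1 + 1"
  define s2 where "s2 = real n2 + 1"
  define s where "s = real n + 1"
  define u where "u = log 2 (A / s)"
  define v where "v = (s2 - 1) / s2"
  have pos: "A > 0" "A1 > 0" "A2 > 0" "s1 \<ge> 1" "s2 \<ge> 1" "s = s1 + s2" "s > 0" "A1 + A2 \<le> A"
    using n m by (auto simp: A_def A1_def A2_def s1_def s2_def s_def)
  have s12: "s1 \<le> s2" "s2 \<le> s1 + 1" using n by (auto simp: s1_def s2_def)
  have cases: "s2 = s1 \<or> s2 = s1 + 1 \<and> s2 \<ge> 2"
    using n by (auto simp: s1_def s2_def)
  have t1: "log 2 (A1 / s1) \<le> u + (A1 / s1 / (A / s) - 1) / ln 2"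
    unfolding u_def using pos by (intro log_le_tangent) auto
  have t2: "log 2 (A2 / s2) \<le> u + (A2 / s2 / (A / s) - 1) / ln 2"
    unfolding u_def using pos by (intro log_le_tangent) auto
  define E where "E = (s1 - 1) * (A1 / s1 / (A / s) - 1) + (s2 - 1) * (A2 / s2 / (A / s) - 1)"
  have "(s1 - 1) * log 2 (A1 / s1) + (s2 - 1) * log 2 (A2 / s2)
      \<le> (s1 - 1) * (u + (A1 / s1 / (A / s) - 1) / ln 2) +
        (s2 - 1) * (u + (A2 / s2 / (A / s) - 1) / ln 2)"
    using t1 t2 pos by (intro add_mono mult_left_mono) auto
  also have "\<dots> = (s - 2) * u + E / ln 2"
    using pos(6) by (simp add: E_def algebra_simps add_divide_distrib diff_divide_distrib)
  finally have sum: "(s1 - 1) * log 2 (A1 / s1) + (s2 - 1) * log 2 (A2 / s2)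
      \<le> (s - 2) * u + E / ln 2" .
  have "E = s / A * ((s1 - 1) / s1 * A1 + v * A2) - (s - 2)"
  proof -
    have "(x - 1) * (a / x / (A / s) - 1) = s / A * ((x - 1) / x * a) - (x - 1)" for x a
      by (simp add: right_diff_distrib) (simp add: mult_ac)
    note this[of s1 A1] this[of s2 A2]
    then show ?thesis unfolding E_def v_def distrib_left using pos(6) by linarith
  qed
  \<comment> \<open>\<open>v\<close> is the larger of the two coefficients because
    \<open>s1 \<le> s2\<close>; with it only \<open>A1 + A2\<close> matters.\<close>
  also have "\<dots> \<le> s / A * (v * A1 + v * A2) - (s - 2)"
  proof -
    have "(s1 - 1) / s1 \<le> v" using pos s12 by (simp add: v_def field_simps)
    then show ?thesis using pos by (intro diff_right_mono mult_left_mono add_mono mult_right_mono) auto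
  qed
  also have "\<dots> \<le> s / A * (v * A) - (s - 2)"
  proof -
    have "v \<ge> 0" using pos by (simp add: v_def)
    then have "v * (A1 + A2) \<le> v * A" using pos by (intro mult_left_mono) auto
    then show ?thesis using pos by (intro diff_right_mono mult_left_mono) (auto simp: algebra_simps)
  qed
  also have "\<dots> = s * v - (s - 2)" using pos by simp
  also have "\<dots> \<le> 1 / 2" using cases
  proof
    assume "s2 = s1"
    then show ?thesis using pos by (simp add: v_def field_simps)
  next
    assume "s2 = s1 + 1 \<and> s2 \<ge> 2"
    then have "s * v - (s - 2) = 1 / s2" "1 / s2 \<le> 1 / 2" using pos
      by (auto simp: v_def field_simps)
    then show ?thesis by simp
  qed
  finally have E: "E \<le> 1 / 2" .
  have "ln (1 / 2 :: real) \<le> 1 / 2 - 1" by (rule ln_le_minus_one) auto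
  then have ln2: "ln (2 :: real) \<ge> 1 / 2" by (simp add: ln_div)
  have E1: "E / ln 2 \<le> 1" using E ln2 by (simp add: field_simps)
  \<comment> \<open>\<open>s * s\<close> equals \<open>4 * s1 * s2\<close> plus the squared
    difference, which is at most 1; the factor 8 is a convenient power of two above 5.\<close>
  have "s * s \<le> 8 * (s1 * s2)"
  proof -
    have "(s2 - s1) * (s2 - s1) \<le> 1 * 1" using s12 by (intro mult_mono) auto
    moreover have "1 * 1 \<le> s1 * s2" using pos by (intro mult_mono) auto
    ultimately show ?thesis unfolding pos(6) by (simp add: algebra_simps)
  qed
  then have "log 2 (s * s) \<le> log 2 (8 * (s1 * s2))" using pos by simp
  moreover have "log 2 (s * s) = 2 * log 2 s" using pos by (simp add: log_mult)
  moreover have "log 2 8 = (3::real)" using log_pow_cancel[of 2 3] by simp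
  then have "log 2 (8 * (s1 * s2)) = 3 + log 2 s1 + log 2 s2" using pos by (simp add: log_mult)
  ultimately have l: "2 * log 2 s \<le> 3 + log 2 s1 + log 2 s2" by simp
  have "log 2 (real m + 1) \<le> log 2 A" by (simp add: A_def)
  moreover have "log 2 A = u + log 2 s" using pos by (simp add: u_def log_divide)
  ultimately have lm: "log 2 (real m + 1) \<le> u + log 2 s" by simp
  have F: "rect_cost m n = (s - 1) * u + 5 * (s - 1) - log 2 s"
    by (simp add: rect_cost_def s_def u_def A_def add_ac)
  have F1: "rect_cost m1 n1 = (s1 - 1) * log 2 (A1 / s1) + 5 * (s1 - 1) - log 2 s1"
    by (simp add: rect_cost_def s1_def A1_def add_ac)
  have F2: "rect_cost m2 n2 = (s2 - 1) * log 2 (A2 / s2) + 5 * (s2 - 1) - log 2 s2"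
    by (simp add: rect_cost_def s2_def A2_def add_ac)
  have su: "(s - 1) * u = (s - 2) * u + u" by (simp add: algebra_simps)
  have "5 * (s1 - 1) + 5 * (s2 - 1) = 5 * (s - 1) - 5" using pos(6) by simp
  then show ?thesis unfolding F F1 F2 su using sum E1 l lm by argo
qed

text \<open>The premise \<open>rect_cost (r - l) n < k + 1\<close> says that \<open>k\<close> is at
  least the floor of the cost.\<close>

lemma clears_rect:
  assumes "M > 0" "N > 0" "l \<le> r" "r \<le> M" "b + n \<le> N" "rect_cost (r - l) n < k + 1"
  shows "clears [M, N] k (rect l r b (b + n))"
  using assms
proof (induction n arbitrary: l r b k rule: less_induct)
  case (less n)
  have ne: "grid [M, N] \<noteq> {}" using less.prems by (intro grid_2_nonempty)
  show ?case
  proof (cases "n = 0")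
    case True
    then have "rect l r b (b + n) = {}" by (auto simp: rect_def)
    then show ?thesis using clears_mono[OF ne, of 0 "{}" k] by simp
  next
    case False
    define m where "m = r - l"
    define n1 where "n1 = (n - 1) div 2"
    define n2 where "n2 = n - 1 - n1"
    have n: "n = n1 + n2 + 1" "n1 \<le> n2" "n2 \<le> n1 + 1"
      using False by (auto simp: n1_def n2_def)
    define y where "y = b + n1"
    have e: "b + n = Suc y + n2" using n by (simp add: y_def)
    define s where "s = nat \<lceil>log 2 (real m + 1)\<rceil>"
    have s: "log 2 (real m + 1) \<le> s" "s \<le> log 2 (real m + 1) + 1"
      unfolding s_def by (auto simp: real_nat_ceiling_ge of_nat_nat)
    have "real m + 1 \<le> 2 ^ s"
      using s(1) by (simp add: log_le_iff powr_realpow)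
    then have ms: "m < 2 ^ s"
      by (metis of_nat_1 of_nat_add of_nat_le_iff of_nat_numeral of_nat_power Suc_eq_plus1 Suc_le_eq)
    have bound: "rect_cost m1 n2 + rect_cost m2 n1 + s < k + 1" if "m1 + m2 \<le> m" for m1 m2
      using rect_cost_split[OF n, of m2 m1 m] that s(2) less.prems(6) unfolding m_def by simp
    have sk: "s \<le> k"
      using bound[of 0 0] rect_cost_nonneg[of 0 n1] rect_cost_nonneg[of 0 n2] by simp
    \<comment> \<open>Initially both rectangles and the row have width \<open>m\<close>, so the
      invariant holds with equality: \<open>m + m\<close> on both sides.\<close>
    have "clears [M, N] (s + (k - s))
        (rect l r (Suc y) (Suc y + n2) \<union> rect l r b y \<union> rect l r y (Suc y))"
    proof (rule clears_two_rects_and_row[where m = m])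
      fix ul ur ll lr
      assume h: "ul \<le> ur" "ll \<le> lr" "ur \<le> M" "lr \<le> M" "(ur - ul) + (lr - ll) \<le> m"
      define k1 where "k1 = nat \<lfloor>rect_cost (ur - ul) n2\<rfloor>"
      define k2 where "k2 = nat \<lfloor>rect_cost (lr - ll) n1\<rfloor>"
      have k1: "real k1 \<le> rect_cost (ur - ul) n2" "rect_cost (ur - ul) n2 < k1 + 1"
        unfolding k1_def using rect_cost_nonneg[of "ur - ul" n2] by (auto simp: of_nat_nat) linarith+
      have k2: "real k2 \<le> rect_cost (lr - ll) n1" "rect_cost (lr - ll) n1 < k2 + 1"
        unfolding k2_def using rect_cost_nonneg[of "lr - ll" n1] by (auto simp: of_nat_nat) linarith+
      have "clears [M, N] k1 (rect ul ur (Suc y) (Suc y + n2))"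
        by (rule less.IH) (use n h less.prems k1 e in auto)
      moreover have "clears [M, N] k2 (rect ll lr b (b + n1))"
        by (rule less.IH) (use n h less.prems k2 in auto)
      ultimately have "clears [M, N] (k1 + k2) (rect ul ur (Suc y) (Suc y + n2) \<union> rect ll lr b y)"
        unfolding y_def by (rule clears_Un)
      \<comment> \<open>Rounding down loses nothing: \<open>k1 + k2 + s\<close> is an integer below
        \<open>k + 1\<close>.\<close>
      moreover have "k1 + k2 \<le> k - s" using bound[OF h(5)] k1(1) k2(1) sk by linarith
      ultimately show "clears [M, N] (k - s) (rect ul ur (Suc y) (Suc y + n2) \<union> rect ll lr b y)"
        using clears_mono[OF ne] by blast
    qed (use less.prems ms n ne in \<open>auto simp: m_def y_def\<close>)
    then have "clears [M, N] k
        (rect l r (Suc y) (Suc y + n2) \<union> rect l r b y \<union> rect l r y (Suc y))"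
      using sk by simp
    then show ?thesis
      by (rule clears_subset) (auto simp: rect_def e)
  qed
qed

section \<open>Diagonal blocks\<close>

text \<open>The sum is a potential that Adversary can keep from dropping by more than 1 per query;
  it is 0 when no candidate is left.\<close>

lemma clears_ge_blocks:
  fixes w :: nat
  defines "B \<equiv> \<lambda>y. {[x, y] | x. y * w \<le> x \<and> x < Suc y * w}"
  assumes "clears [m, n] k C"
  shows "(\<Sum>y<n. log 2 (real (card (C \<inter> B y)) + 1)) \<le> k"
  using assms(2)
proof (induction k arbitrary: C)
  case 0
  then show ?case by simp
next
  case (Suc k)
  have finB: "finite (B y)" for y
  proof -
    have "B y = (\<lambda>x. [x, y]) ` {y * w..<Suc y * w}" by (auto simp: B_def)
    then show ?thesis by simp
  qed
  from Suc.prems obtain x y where y: "y < n"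
    and q: "\<And>a. length a = 2 \<Longrightarrow> clears [m, n] k {t \<in> C. t \<noteq> [x, y] \<and> legal_answer t [x, y] a}"
    by (auto simp: grid_2 rect_def numeral_2_eq_2)
  define D where "D = (\<lambda>a. {t \<in> C. t \<noteq> [x, y] \<and> legal_answer t [x, y] a})"
  have above: "x' < Suc y' * w \<Longrightarrow> y' < z \<Longrightarrow> x' < z * w" for x' y' z
    by (meson Suc_leI less_le_trans mult_le_mono1)
  have below: "z * w \<le> x' \<Longrightarrow> y' < z \<Longrightarrow> Suc y' * w \<le> x'" for x' y' z
    by (meson Suc_leI le_trans mult_le_mono1)
  have "\<exists>a. length a = 2 \<and> (\<forall>z. z \<noteq> y \<longrightarrow> D a \<inter> B z = C \<inter> B z) \<and>
      card (C \<inter> B y) \<le> 2 * card (D a \<inter> B y) + 1"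
  proof (cases "y * w \<le> x \<and> x < Suc y * w")
    \<comment> \<open>Blocks of smaller rows lie to the left of \<open>x\<close> and those of larger
      rows to the right, so both answers keep them whole. Together the two answers keep all of block
      \<open>y\<close> except the query, so one keeps at least half of that.\<close>
    case True
    have other: "D a \<inter> B z = C \<inter> B z" if "z \<noteq> y" "a = [Gt, Lt] \<or> a = [Lt, Gt]" for a z
    proof -
      have "t \<in> D a" if "t \<in> C" "t \<in> B z" for t
      proof -
        obtain x' where t: "t = [x', z]" "z * w \<le> x'" "x' < Suc z * w"
          using \<open>t \<in> B z\<close> unfolding B_def by blast
        have "z < y \<Longrightarrow> x' < x" using above[OF t(3), of y] True by linarith
        moreover have "z > y \<Longrightarrow> x' > x" using below[OF t(2), of y] True by linarith
        ultimately show ?thesis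
          using that \<open>z \<noteq> y\<close> \<open>a = [Gt, Lt] \<or> a = [Lt, Gt]\<close>
          by (cases "z < y") (auto simp: D_def t(1) legal_answer_2)
      qed
      then show ?thesis by (auto simp: D_def)
    qed
    have "C \<inter> B y \<subseteq> insert [x, y] ((D [Gt, Lt] \<inter> B y) \<union> (D [Lt, Gt] \<inter> B y))"
      by (auto simp: B_def D_def legal_answer_2)
    then have "card (C \<inter> B y) \<le> card (insert [x, y] ((D [Gt, Lt] \<inter> B y) \<union> (D [Lt, Gt] \<inter> B y)))"
      using finB by (intro card_mono) auto
    also have "\<dots> \<le> Suc (card ((D [Gt, Lt] \<inter> B y) \<union> (D [Lt, Gt] \<inter> B y)))"
      by (rule card_insert_le_m1) auto
    also have "\<dots> \<le> Suc (card (D [Gt, Lt] \<inter> B y) + card (D [Lt, Gt] \<inter> B y))"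
      using card_Un_le by auto
    finally have "card (C \<inter> B y) \<le> 2 * card (D [Gt, Lt] \<inter> B y) + 1 \<or>
        card (C \<inter> B y) \<le> 2 * card (D [Lt, Gt] \<inter> B y) + 1" by linarith
    then show ?thesis using other
      by (metis (no_types, lifting) length_Cons list.size(3) numeral_2_eq_2)
  next
    case False
    \<comment> \<open>A query outside the block of its row can be answered without removing any
      block element.\<close>
    define a where "a = (if x < y * w then [Gt, Lt] else [Lt, Gt])"
    have "D a \<inter> B z = C \<inter> B z" for z
    proof -
      have "t \<in> D a" if "t \<in> C" "t \<in> B z" for t
      proof -
        obtain x' where t: "t = [x', z]" "z * w \<le> x'" "x' < Suc z * w"
          using \<open>t \<in> B z\<close> unfolding B_def by blast
        have 1: "x' > x" if "x < y * w" "z \<ge> y"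
          using that t(2) mult_le_mono1[of y z w] by linarith
        have 2: "x' < x" if "x \<ge> Suc y * w" "z \<le> y"
          using that t(3) mult_le_mono1[of "Suc z" "Suc y" w] by linarith
        show ?thesis
        proof (cases "x < y * w")
          case True
          then show ?thesis using 1 \<open>t \<in> C\<close>
            by (cases "z < y") (auto simp: D_def a_def t(1) legal_answer_2)
        next
          case F: False
          then have "x \<ge> Suc y * w" using False by auto
          then show ?thesis using F 2 \<open>t \<in> C\<close>
            by (cases "z > y") (auto simp: D_def a_def t(1) legal_answer_2)
        qed
      qed
      then show ?thesis by (auto simp: D_def)
    qed
    then show ?thesis by (intro exI[of _ a]) (auto simp: a_def)
  qed
  then obtain a where a: "length a = 2" "\<And>z. z \<noteq> y \<Longrightarrow> D a \<inter> B z = C \<inter> B z"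
    "card (C \<inter> B y) \<le> 2 * card (D a \<inter> B y) + 1" by blast
  \<comment> \<open>The \<open>+ 1\<close> inside the logarithm absorbs the loss of the queried
    point itself.\<close>
  have "log 2 (real (card (C \<inter> B y)) + 1) \<le> log 2 (2 * (real (card (D a \<inter> B y)) + 1))"
    using a(3) by simp
  also have "\<dots> = log 2 (real (card (D a \<inter> B y)) + 1) + 1"
    by (subst log_mult) auto
  finally have 1: "log 2 (real (card (C \<inter> B y)) + 1) \<le> log 2 (real (card (D a \<inter> B y)) + 1) + 1" .
  have split: "(\<Sum>z<n. f z) = f y + (\<Sum>z\<in>{..<n} - {y}. f z)" for f :: "nat \<Rightarrow> real"
    using y by (intro sum.remove) auto
  have "(\<Sum>z<n. log 2 (real (card (C \<inter> B z)) + 1))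
      \<le> (\<Sum>z<n. log 2 (real (card (D a \<inter> B z)) + 1)) + 1"
    using 1 a(2) by (simp add: split)
  also have "\<dots> \<le> real k + 1" using Suc.IH[of "D a"] q[OF a(1)] by (simp add: D_def)
  finally show ?case by simp
qed

lemma clears_grid_ge:
  assumes n: "n \<ge> 1" and k: "clears [m, n] k (grid [m, n])"
  shows "real n * log 2 (real (m div n) + 1) \<le> k"
proof -
  define w where "w = m div n"
  have "card (grid [m, n] \<inter> {[x, y] | x. y * w \<le> x \<and> x < Suc y * w}) = w" if "y < n" for y
  proof -
    have "Suc y * w \<le> n * w" using that by (intro mult_le_mono1) auto
    also have "\<dots> \<le> m" by (simp add: w_def)
    finally have "grid [m, n] \<inter> {[x, y] | x. y * w \<le> x \<and> x < Suc y * w} =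
        (\<lambda>x. [x, y]) ` {y * w..<Suc y * w}"
      using that by (auto simp: grid_2 rect_def)
    also have "card \<dots> = w" by (subst card_image) (auto simp: inj_on_def)
    finally show ?thesis .
  qed
  then show ?thesis using clears_ge_blocks[OF k, of w] by (simp add: w_def)
qed

section \<open>Both bounds for the full grid\<close>

theorem theorem1:
  "(\<forall>m n :: nat. 1 \<le> n \<and> n \<le> m \<longrightarrow>
      real (qc [m, n]) \<le> 2 * real n * (log 2 (real m / (real n + 1)) + 4)) \<and>
   (\<exists>c :: real. c > 0 \<and> (\<forall>m n :: nat. 1 \<le> n \<and> n \<le> m \<longrightarrow>
      real (qc [m, n]) \<ge> c * (2 * real n * (log 2 (real m / (real n + 1)) + 4))))"
proof (intro conjI exI[of _ "1 / 10 :: real"] allI impI)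
  fix m n :: nat
  assume mn: "1 \<le> n \<and> n \<le> m"
  define r where "r = real m / (real n + 1)"
  have r: "r \<ge> 1 / 2" using mn by (simp add: r_def field_simps)
  have ne: "grid [m, n] \<noteq> {}" using mn by (intro grid_2_nonempty) auto
  define k where "k = nat \<lfloor>rect_cost m n\<rfloor>"
  have k: "real k \<le> rect_cost m n" "rect_cost m n < k + 1"
    unfolding k_def using rect_cost_nonneg[of m n] by (auto simp: of_nat_nat) linarith+
  have "clears [m, n] k (rect 0 m 0 (0 + n))"
    by (rule clears_rect) (use mn k in auto)
  then have cl: "clears [m, n] k (grid [m, n])" by (simp add: grid_2)
  \<comment> \<open>The inequality \<open>1 + r \<le> 8 * r * r\<close>, valid as
    \<open>r \<ge> 1 / 2\<close>, turns \<open>log 2 (1 + r) + 5\<close> into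
    \<open>2 * (log 2 r + 4)\<close>.\<close>
  have "0 \<le> (2 * r - 1) * (4 * r + 1) + r"
    using r by (intro add_nonneg_nonneg mult_nonneg_nonneg) auto
  then have "1 + r \<le> 8 * (r * r)" using r by (simp add: algebra_simps)
  then have "log 2 (1 + r) \<le> log 2 (8 * (r * r))" using r by simp
  also have "log 2 8 = (3::real)" using log_pow_cancel[of 2 3] by simp
  then have "log 2 (8 * (r * r)) = 3 + 2 * log 2 r" using r by (simp add: log_mult)
  finally have lr: "log 2 (1 + r) \<le> 3 + 2 * log 2 r" .
  have "real (qc [m, n]) \<le> k" using qc_le[OF ne cl] by simp
  also have "\<dots> \<le> n * log 2 (1 + r) + 5 * n"
  proof -
    have "(real m + real n + 1) / (real n + 1) = 1 + r" by (simp add: r_def field_simps)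
    then have "rect_cost m n = n * log 2 (1 + r) + 5 * n - log 2 (n + 1)"
      by (simp add: rect_cost_def add_ac)
    moreover have "log 2 (real (n + 1)) \<ge> 0" by simp
    ultimately show ?thesis using k(1) by linarith
  qed
  also have "\<dots> \<le> n * (3 + 2 * log 2 r) + 5 * n"
    using lr by (intro add_right_mono mult_left_mono) auto
  finally show "real (qc [m, n]) \<le> 2 * real n * (log 2 (real m / (real n + 1)) + 4)"
    by (simp add: r_def algebra_simps)
  define w where "w = m div n"
  have w: "w \<ge> 1" using mn by (simp add: w_def div_greater_zero_iff Suc_le_eq)
  have q: "real n * log 2 (real w + 1) \<le> qc [m, n]"
    unfolding w_def using mn clears_qc[OF ne cl] by (intro clears_grid_ge) auto
  have "m < Suc w * n" unfolding w_def using mn by (simp add: dividend_less_div_times)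
  then have "real m < real (Suc w * n)" by (simp only: of_nat_less_iff)
  also have "\<dots> \<le> (real w + 1) * (real n + 1)" by (simp add: algebra_simps)
  finally have "r \<le> real w + 1" by (simp add: r_def field_simps)
  then have "log 2 r \<le> log 2 (real w + 1)" using r by simp
  moreover have "1 \<le> log 2 (real w + 1)" using w by simp
  \<comment> \<open>Since \<open>w \<ge> 1\<close>, the 4 costs four more copies of
    \<open>log 2 (w + 1)\<close>. The resulting factor 5, doubled, gives the constant
    \<open>1 / 10\<close>.\<close>
  ultimately have "log 2 r + 4 \<le> 5 * log 2 (real w + 1)" by linarith
  then have "real n * (log 2 r + 4) \<le> real n * (5 * log 2 (real w + 1))"
    by (intro mult_left_mono) auto
  also have "\<dots> \<le> 5 * qc [m, n]" using q by simp
  finally show "1 / 10 * (2 * real n * (log 2 (real m / (real n + 1)) + 4)) \<le> real (qc [m, n])"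
    by (simp add: r_def)
qed simp

end
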